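(* Let $k\ge2$, let $M$ be a compact $C^\infty$ manifold and let $(\mu,\alpha)\in\mathfrak E^r(\mathbb R^k\curvearrowright M)$ be an essentially locally free ergodic system with exactly $k+1$ distinct Lyapunov hyperplanes. If $\mathrm{ent}_\mu(\alpha_t)>0$ for all $t\in\mathbb R^k\setminus\{0\}$, and for some $t^\ast\in\mathbb R^k$ the system $(\mu,\alpha_{t^\ast})\in\mathfrak E^r(\mathbb Z\curvearrowright M)$ has the $K$-property, then $\dim(M)\ge 2k+1$.
   Context: Let $\theta\in(0,1]$, $r=(1,\theta)$; $C^r$ means continuously differentiable with $\theta$-Hölder first derivative. $\mathfrak E^r(\mathbb R^k\curvearrowright M)$ is the set of pairs $(\mu,\alpha)$ where $\alpha_\bullet:\mathbb R^k\to\mathrm{Diff}^r(M)$ is a group homomorphism such that $(t,x)\mapsto\alpha_t(x)$ is $C^r$, and $\mu$ is an $\alpha$-invariant Borel probability measure; $(\mu,\alpha_{t^\ast})\in\mathfrak E^r(\mathbb Z\curvearrowright M)$ denotes the $\mathbb Z$-system generated by the diffeomorphism $\alpha_{t^\ast}$. Essentially locally free means that $\mu$-a.e. stabilizer is discrete. $\mathrm{ent}_\mu$ is Kolmogorov–Sinai entropy. The $K$-property means being a Kolmogorov automorphism (no nontrivial measurable factor of zero entropy). For an essentially locally free ergodic system, the Oseledets theorem gives finitely many distinct linear functionals $\chi^i:\mathbb R^k\to\mathbb R$ (nonorbital Lyapunov exponents) and for $\mu$-a.e. $x$ a measurable invariant splitting $T_xM=O_x\oplus\bigoplus_iL^i_x$,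 $L^i_x\neq0$, with $O_x$ tangent to the orbit and $\log|T_x\alpha_tv|=\chi^i(t)+o(|t|)$ as $|t|\to\infty$ uniformly over unit $v\in L^i_x$. Lyapunov hyperplanes are the kernels of the nonzero exponents. *)

theory Defs
  imports "HOL-Probability.Probability"
begin

section \<open>Smooth manifolds\<close>

primrec times_cont_diff_on :: "nat \<Rightarrow> ('a::euclidean_space \<Rightarrow> 'b::euclidean_space) \<Rightarrow> 'a set \<Rightarrow> bool" where
  "times_cont_diff_on 0 f S \<longleftrightarrow> continuous_on S f"
| "times_cont_diff_on (Suc n) f S \<longleftrightarrow>
     (\<forall>x\<in>S. f differentiable (at x)) \<and>
     (\<forall>v. times_cont_diff_on n (\<lambda>x. frechet_derivative f (at x) v) S)"

definition smooth_on :: "('a::euclidean_space \<Rightarrow> 'b::euclidean_space) \<Rightarrow> 'a set \<Rightarrow> bool" where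
  "smooth_on f S \<longleftrightarrow> (\<forall>n. times_cont_diff_on n f S)"

text \<open>A chart is a pair of its domain and its coordinate map. The coordinate map is total, but only
  its values on the domain matter.\<close>

type_synonym ('m, 'e) chart = "'m set \<times> ('m \<Rightarrow> 'e)"

abbreviation dom_chart :: "('m, 'e) chart \<Rightarrow> 'm set" where
  "dom_chart c \<equiv> fst c"

abbreviation coord :: "('m, 'e) chart \<Rightarrow> 'm \<Rightarrow> 'e" where
  "coord c \<equiv> snd c"

definition inv_chart :: "('m, 'e) chart \<Rightarrow> 'e \<Rightarrow> 'm" where
  "inv_chart c = inv_into (dom_chart c) (coord c)"

definition is_chart :: "('m::topological_space, 'e::euclidean_space) chart \<Rightarrow> bool" where
  "is_chart c \<longleftrightarrow> open (dom_chart c) \<and> open (coord c ` dom_chart c) \<and>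
     homeomorphism (dom_chart c) (coord c ` dom_chart c) (coord c) (inv_chart c)"

text \<open>The expression of \<open>f\<close> in the chart \<open>c\<close> of the source and the chart \<open>d\<close> of the target,
  meaningful on \<open>local_dom c d f\<close>.\<close>

definition local_rep :: "('m, 'a) chart \<Rightarrow> ('n, 'b) chart \<Rightarrow> ('m \<Rightarrow> 'n) \<Rightarrow> 'a \<Rightarrow> 'b" where
  "local_rep c d f = (\<lambda>y. coord d (f (inv_chart c y)))"

definition local_dom :: "('m, 'a) chart \<Rightarrow> ('n, 'b) chart \<Rightarrow> ('m \<Rightarrow> 'n) \<Rightarrow> 'a set" where
  "local_dom c d f = coord c ` (dom_chart c \<inter> f -` dom_chart d)"

definition smooth_atlas :: "('m::topological_space, 'e::euclidean_space) chart set \<Rightarrow> bool" where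
  "smooth_atlas A \<longleftrightarrow> (\<forall>c\<in>A. is_chart c) \<and> (\<Union>c\<in>A. dom_chart c) = UNIV \<and>
     (\<forall>c\<in>A. \<forall>d\<in>A. smooth_on (local_rep c d id) (local_dom c d id))"

text \<open>With the type class constraints on \<open>'m\<close> this says that the whole type \<open>'m\<close> with the smooth
  structure generated by \<open>A\<close> is a compact boundaryless manifold of dimension \<open>DIM('e)\<close>.\<close>

definition compact_smooth_manifold ::
    "('m::{second_countable_topology, t2_space}, 'e::euclidean_space) chart set \<Rightarrow> bool" where
  "compact_smooth_manifold A \<longleftrightarrow> compact (UNIV :: 'm set) \<and> smooth_atlas A"

definition euclidean_atlas :: "('a::euclidean_space, 'a) chart set" where
  "euclidean_atlas = {(UNIV, id)}"

definition prod_atlas ::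
    "('m, 'a) chart set \<Rightarrow> ('n, 'b) chart set \<Rightarrow> ('m \<times> 'n, 'a \<times> 'b) chart set" where
  "prod_atlas A B =
     (\<lambda>(c, d). (dom_chart c \<times> dom_chart d, map_prod (coord c) (coord d))) ` (A \<times> B)"


section \<open>Maps and actions of class \<open>C\<^sup>r\<close>, where \<open>r = (1, \<theta>)\<close>\<close>

text \<open>The Hoelder condition is local: a global constant makes no sense in arbitrary charts, nor on
  the noncompact product of the acting group and the manifold.\<close>

definition C1_holder_on ::
    "real \<Rightarrow> ('a::euclidean_space \<Rightarrow> 'b::euclidean_space) \<Rightarrow> 'a set \<Rightarrow> bool" where
  "C1_holder_on \<theta> f S \<longleftrightarrow>
     (\<exists>f' :: 'a \<Rightarrow> 'a \<Rightarrow>\<^sub>L 'b.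
        (\<forall>x\<in>S. (f has_derivative blinfun_apply (f' x)) (at x)) \<and>
        continuous_on S f' \<and>
        (\<forall>x\<in>S. \<exists>\<delta>>0. \<exists>K. \<forall>y \<in> S \<inter> ball x \<delta>. \<forall>z \<in> S \<inter> ball x \<delta>.
           norm (f' y - f' z) \<le> K * dist y z powr \<theta>))"

definition Cr_map ::
    "real \<Rightarrow> ('m::topological_space, 'a::euclidean_space) chart set \<Rightarrow>
     ('n::topological_space, 'b::euclidean_space) chart set \<Rightarrow> ('m \<Rightarrow> 'n) \<Rightarrow> bool" where
  "Cr_map \<theta> A B f \<longleftrightarrow> continuous_on UNIV f \<and>
     (\<forall>c\<in>A. \<forall>d\<in>B. C1_holder_on \<theta> (local_rep c d f) (local_dom c d f))"

definition Diff_r ::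
    "real \<Rightarrow> ('m::topological_space, 'e::euclidean_space) chart set \<Rightarrow> ('m \<Rightarrow> 'm) set" where
  "Diff_r \<theta> A = {f. bij f \<and> Cr_map \<theta> A A f \<and> Cr_map \<theta> A A (inv f)}"

text \<open>The set of pairs of a \<open>C\<^sup>r\<close> action of \<open>\<real>\<^sup>k\<close> and an invariant Borel probability measure.\<close>

definition Er_systems ::
    "real \<Rightarrow> ('m::topological_space, 'e::euclidean_space) chart set \<Rightarrow>
     ('m measure \<times> ((real ^ 'k) \<Rightarrow> 'm \<Rightarrow> 'm)) set" where
  "Er_systems \<theta> A = {(\<mu>, \<alpha>).
     (\<forall>t. \<alpha> t \<in> Diff_r \<theta> A) \<and> \<alpha> 0 = id \<and> (\<forall>s t. \<alpha> (s + t) = \<alpha> s \<circ> \<alpha> t) \<and>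
     Cr_map \<theta> (prod_atlas euclidean_atlas A) A (\<lambda>(t, x). \<alpha> t x) \<and>
     prob_space \<mu> \<and> sets \<mu> = sets borel \<and> (\<forall>t. distr \<mu> borel (\<alpha> t) = \<mu>)}"

definition stabilizer :: "('g \<Rightarrow> 'm \<Rightarrow> 'm) \<Rightarrow> 'm \<Rightarrow> 'g set" where
  "stabilizer \<alpha> x = {t. \<alpha> t x = x}"

definition essentially_locally_free ::
    "'m measure \<Rightarrow> ('g::topological_space \<Rightarrow> 'm \<Rightarrow> 'm) \<Rightarrow> bool" where
  "essentially_locally_free \<mu> \<alpha> \<longleftrightarrow> (AE x in \<mu>. topological_space_class.discrete (stabilizer \<alpha> x))"

definition ergodic_action :: "'m measure \<Rightarrow> ('g \<Rightarrow> 'm \<Rightarrow> 'm) \<Rightarrow> bool" where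
  "ergodic_action \<mu> \<alpha> \<longleftrightarrow>
     (\<forall>B\<in>sets \<mu>. (\<forall>t. \<alpha> t -` B \<inter> space \<mu> = B) \<longrightarrow> measure \<mu> B = 0 \<or> measure \<mu> B = 1)"


section \<open>Entropy and the K-property\<close>

definition finite_measurable_partition :: "'m measure \<Rightarrow> 'm set set \<Rightarrow> bool" where
  "finite_measurable_partition M P \<longleftrightarrow> finite P \<and> P \<subseteq> sets M \<and> partition_on (space M) P"

definition partition_entropy :: "'m measure \<Rightarrow> 'm set set \<Rightarrow> real" where
  "partition_entropy M P = - (\<Sum>B\<in>P. measure M B * ln (measure M B))"

text \<open>The join of the preimages of \<open>P\<close> under \<open>f ^^ i\<close> for \<open>i < n\<close>. It may contain the empty set,
  which does not contribute to the entropy because \<open>0 * ln 0 = 0\<close>.\<close>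

primrec iterated_join :: "'m measure \<Rightarrow> ('m \<Rightarrow> 'm) \<Rightarrow> 'm set set \<Rightarrow> nat \<Rightarrow> 'm set set" where
  "iterated_join M f P 0 = {space M}"
| "iterated_join M f P (Suc n) =
     {B \<inter> (f ^^ n) -` C |B C. B \<in> iterated_join M f P n \<and> C \<in> P}"

text \<open>Kolmogorov--Sinai entropy; the limit exists by subadditivity when \<open>f\<close> preserves the
  probability measure \<open>M\<close>.\<close>

definition KS_entropy :: "'m measure \<Rightarrow> ('m \<Rightarrow> 'm) \<Rightarrow> ereal" where
  "KS_entropy M f =
     (SUP P \<in> Collect (finite_measurable_partition M).
        ereal (lim (\<lambda>n. partition_entropy M (iterated_join M f P n) / real n)))"

definition mp_automorphism :: "'m measure \<Rightarrow> ('m \<Rightarrow> 'm) \<Rightarrow> bool" where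
  "mp_automorphism M f \<longleftrightarrow> prob_space M \<and> bij_betw f (space M) (space M) \<and>
     f \<in> measurable M M \<and> the_inv_into (space M) f \<in> measurable M M \<and> distr M M f = M"

definition is_factor ::
    "'m measure \<Rightarrow> ('m \<Rightarrow> 'm) \<Rightarrow> 'n measure \<Rightarrow> ('n \<Rightarrow> 'n) \<Rightarrow> ('m \<Rightarrow> 'n) \<Rightarrow> bool" where
  "is_factor M f N g \<pi> \<longleftrightarrow> mp_automorphism N g \<and> \<pi> \<in> measurable M N \<and> distr M N \<pi> = N \<and>
     (AE x in M. \<pi> (f x) = g (\<pi> x))"

definition trivial_measure :: "'n measure \<Rightarrow> bool" where
  "trivial_measure N \<longleftrightarrow> (\<forall>B\<in>sets N. measure N B = 0 \<or> measure N B = 1)"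

text \<open>Letting factors live on the type \<open>'m\<close> loses no generality: an invariant sub-sigma-algebra of
  \<open>M\<close> is a factor on \<open>'m\<close> with \<open>\<pi> = id\<close>, and every factor map induces such a sub-sigma-algebra by
  pulling back.\<close>

definition K_property :: "'m measure \<Rightarrow> ('m \<Rightarrow> 'm) \<Rightarrow> bool" where
  "K_property M f \<longleftrightarrow> mp_automorphism M f \<and>
     (\<forall>(N :: 'm measure) g \<pi>. is_factor M f N g \<pi> \<and> KS_entropy N g = 0 \<longrightarrow> trivial_measure N)"


section \<open>Tangent spaces and Lyapunov exponents\<close>

text \<open>A tangent vector at \<open>x\<close> is given by its coordinate vectors in the charts around \<open>x\<close>, which are
  related by the derivatives of the transition maps. Accordingly, \<open>tangent_map c d f x\<close> is the
  tangent map of \<open>f\<close> at \<open>x\<close>, written in the charts \<open>c\<close> around \<open>x\<close> and \<open>d\<close> around \<open>f x\<close>; for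
  \<open>f = id\<close> it is the change of coordinates. A field of tangent subspaces and a Riemannian metric
  are families indexed by charts that respect the change of coordinates.\<close>

definition tangent_map ::
    "('m, 'a::euclidean_space) chart \<Rightarrow> ('n, 'b::euclidean_space) chart \<Rightarrow>
     ('m \<Rightarrow> 'n) \<Rightarrow> 'm \<Rightarrow> 'a \<Rightarrow> 'b" where
  "tangent_map c d f x = frechet_derivative (local_rep c d f) (at (coord c x))"

definition riemannian_metric ::
    "('m, 'e::euclidean_space) chart set \<Rightarrow> (('m, 'e) chart \<Rightarrow> 'm \<Rightarrow> 'e \<Rightarrow> 'e \<Rightarrow> real) \<Rightarrow> bool" where
  "riemannian_metric A g \<longleftrightarrow>
     (\<forall>c\<in>A. \<forall>x\<in>dom_chart c. bilinear (g c x) \<and> (\<forall>u v. g c x u v = g c x v u) \<and>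
        (\<forall>v. v \<noteq> 0 \<longrightarrow> g c x v v > 0)) \<and>
     (\<forall>c\<in>A. \<forall>u v. smooth_on (\<lambda>y. g c (inv_chart c y) u v) (coord c ` dom_chart c)) \<and>
     (\<forall>c\<in>A. \<forall>d\<in>A. \<forall>x \<in> dom_chart c \<inter> dom_chart d. \<forall>u v.
        g d x (tangent_map c d id x u) (tangent_map c d id x v) = g c x u v)"

definition metric_norm ::
    "(('m, 'e) chart \<Rightarrow> 'm \<Rightarrow> 'e \<Rightarrow> 'e \<Rightarrow> real) \<Rightarrow> ('m, 'e) chart \<Rightarrow> 'm \<Rightarrow> 'e \<Rightarrow> real" where
  "metric_norm g c x v = sqrt (g c x v v)"

text \<open>Measurability of the map from points to subspaces is the usual (Effros) one: the set of points
  whose subspace meets a given open set is measurable.\<close>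

definition measurable_subspace_field ::
    "('m::topological_space, 'e::euclidean_space) chart set \<Rightarrow>
     (('m, 'e) chart \<Rightarrow> 'm \<Rightarrow> 'e set) \<Rightarrow> bool" where
  "measurable_subspace_field A L \<longleftrightarrow>
     (\<forall>c\<in>A. \<forall>x\<in>dom_chart c. subspace (L c x)) \<and>
     (\<forall>c\<in>A. \<forall>d\<in>A. \<forall>x \<in> dom_chart c \<inter> dom_chart d. tangent_map c d id x ` L c x = L d x) \<and>
     (\<forall>c\<in>A. \<forall>U. open U \<longrightarrow> {x \<in> dom_chart c. L c x \<inter> U \<noteq> {}} \<in> sets borel)"

definition orbit_tangent ::
    "('m, 'e::euclidean_space) chart \<Rightarrow> ('g::euclidean_space \<Rightarrow> 'm \<Rightarrow> 'm) \<Rightarrow> 'm \<Rightarrow> 'e set" where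
  "orbit_tangent c \<alpha> x = range (frechet_derivative (\<lambda>t. coord c (\<alpha> t x)) (at 0))"

definition direct_sum_decomposition ::
    "'e::real_vector set \<Rightarrow> 'i set \<Rightarrow> ('i \<Rightarrow> 'e set) \<Rightarrow> bool" where
  "direct_sum_decomposition V0 I V \<longleftrightarrow>
     (\<forall>v. \<exists>!(v0, w). v0 \<in> V0 \<and> w \<in> PiE I V \<and> v = v0 + (\<Sum>i\<in>I. w i))"

text \<open>\<open>X\<close> is the set of Lyapunov functionals and \<open>L \<xi>\<close> the subspace field belonging to \<open>\<xi> \<in> X\<close>.\<close>

definition oseledets_splitting ::
    "('m::topological_space, 'e::euclidean_space) chart set \<Rightarrow>
     (('m, 'e) chart \<Rightarrow> 'm \<Rightarrow> 'e \<Rightarrow> 'e \<Rightarrow> real) \<Rightarrow> 'm measure \<Rightarrow> ((real ^ 'k) \<Rightarrow> 'm \<Rightarrow> 'm) \<Rightarrow>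
     ((real ^ 'k) \<Rightarrow> real) set \<Rightarrow> (((real ^ 'k) \<Rightarrow> real) \<Rightarrow> ('m, 'e) chart \<Rightarrow> 'm \<Rightarrow> 'e set) \<Rightarrow> bool"
  where
  "oseledets_splitting A g \<mu> \<alpha> X L \<longleftrightarrow>
     finite X \<and> (\<forall>\<xi>\<in>X. linear \<xi>) \<and>
     (\<forall>\<xi>\<in>X. measurable_subspace_field A (L \<xi>)) \<and>
     (AE x in \<mu>. \<forall>c\<in>A. x \<in> dom_chart c \<longrightarrow>
        direct_sum_decomposition (orbit_tangent c \<alpha> x) X (\<lambda>\<xi>. L \<xi> c x) \<and>
        (\<forall>\<xi>\<in>X. L \<xi> c x \<noteq> {0})) \<and>
     (AE x in \<mu>. \<forall>\<xi>\<in>X. \<forall>t. \<forall>c\<in>A. \<forall>d\<in>A. x \<in> dom_chart c \<and> \<alpha> t x \<in> dom_chart d \<longrightarrow>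
        tangent_map c d (\<alpha> t) x ` L \<xi> c x = L \<xi> d (\<alpha> t x)) \<and>
     (AE x in \<mu>. \<forall>\<xi>\<in>X. \<forall>c\<in>A. x \<in> dom_chart c \<longrightarrow>
        (\<forall>\<epsilon>>0. \<exists>R. \<forall>t. norm t \<ge> R \<longrightarrow>
           (\<forall>d\<in>A. \<alpha> t x \<in> dom_chart d \<longrightarrow>
              (\<forall>v \<in> L \<xi> c x. metric_norm g c x v = 1 \<longrightarrow>
                 \<bar>ln (metric_norm g d (\<alpha> t x) (tangent_map c d (\<alpha> t) x v)) - \<xi> t\<bar>
                   \<le> \<epsilon> * norm t))))"

text \<open>\<open>X\<close> is the set of nonorbital Lyapunov exponents of an essentially locally free ergodic system.
  It exists by the Oseledets theorem and is unique; on a compact manifold it does not depend on the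
  Riemannian metric.\<close>

definition nonorbital_lyapunov_exponents ::
    "('m::topological_space, 'e::euclidean_space) chart set \<Rightarrow> 'm measure \<Rightarrow>
     ((real ^ 'k) \<Rightarrow> 'm \<Rightarrow> 'm) \<Rightarrow> ((real ^ 'k) \<Rightarrow> real) set \<Rightarrow> bool" where
  "nonorbital_lyapunov_exponents A \<mu> \<alpha> X \<longleftrightarrow>
     (\<exists>g L. riemannian_metric A g \<and> oseledets_splitting A g \<mu> \<alpha> X L)"

definition lyapunov_hyperplanes :: "((real ^ 'k) \<Rightarrow> real) set \<Rightarrow> (real ^ 'k) set set" where
  "lyapunov_hyperplanes X = {{t. \<xi> t = 0} |\<xi>. \<xi> \<in> X \<and> \<xi> \<noteq> (\<lambda>_. 0)}"

end

theory Submission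
  imports Defs
begin

text \<open>The inequality is a dimension count in one tangent space. At almost every point \<open>x\<close> the
  tangent space is the direct sum of the orbit direction and of one nonzero space for each nonorbital
  exponent. Distinct Lyapunov hyperplanes are kernels of distinct nonzero exponents, so the second part
  contributes at least \<open>k + 1\<close> (\<open>direct_sum_dim_lower_bound\<close>, \<open>card_lyapunov_hyperplanes_le\<close>).

  The orbit direction contributes \<open>k\<close> (\<open>orbit_tangent_dim\<close>). Indeed, if the derivative at \<open>0\<close> of the
  orbit map \<open>t \<mapsto> \<alpha>\<^sub>t x\<close> kills \<open>v\<close>, then, since \<open>\<alpha>\<^sub>s\<^sub>v\<close> carries the orbit near time \<open>0\<close> to the orbit
  near time \<open>s v\<close>, the curve \<open>s \<mapsto> \<alpha>\<^sub>s\<^sub>v x\<close> has zero derivative everywhere and is constant. The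
  stabilizer of \<open>x\<close> then contains the line \<open>\<real> v\<close>, and as it is discrete, \<open>v = 0\<close>. The total is at
  least \<open>k + (k + 1)\<close>.\<close>

section \<open>Orbit maps\<close>

lemma chart_coord_inj:
  assumes "is_chart c"
  shows "inj_on (coord c) (dom_chart c)"
  using assms unfolding is_chart_def homeomorphism_def by (metis inj_onI)

lemma inv_chart_coord:
  assumes "is_chart c" "x \<in> dom_chart c"
  shows "inv_chart c (coord c x) = x"
  using chart_coord_inj[OF assms(1)] assms(2) unfolding inv_chart_def by simp

lemma is_chart_of_atlas:
  assumes "smooth_atlas A" "c \<in> A"
  shows "is_chart c"
  using assms unfolding smooth_atlas_def by blast

lemma ex_chart_around:
  assumes "smooth_atlas A"
  obtains c where "c \<in> A" "x \<in> dom_chart c"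
  using assms unfolding smooth_atlas_def by blast

lemma Cr_map_local_rep_differentiable:
  assumes "Cr_map \<theta> A B f" "c \<in> A" "d \<in> B" "x \<in> dom_chart c" "f x \<in> dom_chart d"
  shows "local_rep c d f differentiable (at (coord c x))"
proof -
  have "C1_holder_on \<theta> (local_rep c d f) (local_dom c d f)"
    using assms(1-3) unfolding Cr_map_def by blast
  moreover have "coord c x \<in> local_dom c d f"
    using assms(4,5) unfolding local_dom_def by blast
  ultimately show ?thesis
    unfolding C1_holder_on_def differentiable_def by blast
qed

lemma orbit_map_differentiable:
  fixes A :: "('m::topological_space, 'e::euclidean_space) chart set"
    and \<alpha> :: "(real ^ 'k) \<Rightarrow> 'm \<Rightarrow> 'm"
  assumes A: "smooth_atlas A"
    and \<alpha>: "Cr_map \<theta> (prod_atlas euclidean_atlas A) A (\<lambda>(t, x). \<alpha> t x)"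
    and d: "d \<in> A" "\<alpha> t x \<in> dom_chart d"
  shows "(\<lambda>t. coord d (\<alpha> t x)) differentiable (at t)"
proof -
  obtain c where c: "c \<in> A" "x \<in> dom_chart c"
    using ex_chart_around[OF A] .
  \<comment> \<open>In the product chart \<open>C\<close> the action is \<open>C\<^sup>1\<close>; the orbit map is its restriction to the slice
    through \<open>x\<close>.\<close>
  define C :: "((real ^ 'k) \<times> 'm, (real ^ 'k) \<times> 'e) chart"
    where "C = (UNIV \<times> dom_chart c, map_prod id (coord c))"
  have C: "C \<in> prod_atlas euclidean_atlas A"
    using c(1) unfolding prod_atlas_def euclidean_atlas_def C_def by force
  have "inj_on (coord C) (dom_chart C)"
    unfolding C_def using chart_coord_inj[OF is_chart_of_atlas[OF A c(1)]]
    by (auto simp: inj_on_def)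
  then have inv: "inv_chart C (s, coord c x) = (s, x)" for s
    unfolding inv_chart_def using inv_into_f_f[of "coord C" "dom_chart C" "(s, x)"] c(2)
    by (simp add: C_def)
  have "local_rep C d (\<lambda>(t, x). \<alpha> t x) differentiable (at (coord C (t, x)))"
    by (rule Cr_map_local_rep_differentiable[OF \<alpha> C d(1)]) (use c d in \<open>auto simp: C_def\<close>)
  then have "local_rep C d (\<lambda>(t, x). \<alpha> t x) differentiable (at (t, coord c x))"
    by (simp add: C_def)
  moreover have "(\<lambda>s. (s, coord c x)) differentiable (at t)"
    unfolding differentiable_def
    by (rule exI[of _ "\<lambda>h. (h, 0)"]) (auto intro!: derivative_eq_intros)
  ultimately have "(local_rep C d (\<lambda>(t, x). \<alpha> t x) \<circ> (\<lambda>s. (s, coord c x))) differentiable (at t)"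
    using differentiable_chain_at by blast
  then show ?thesis
    by (simp add: local_rep_def inv comp_def)
qed

lemma orbit_map_continuous:
  assumes "Cr_map \<theta> (prod_atlas euclidean_atlas A) A (\<lambda>(t, x). \<alpha> t x)"
  shows "continuous_on UNIV (\<lambda>t. \<alpha> t x)"
proof -
  have "continuous_on UNIV (\<lambda>p. case p of (t, x) \<Rightarrow> \<alpha> t x)"
    using assms unfolding Cr_map_def by blast
  then have "continuous_on UNIV (\<lambda>t. case (t, x) of (t, x) \<Rightarrow> \<alpha> t x)"
    by (rule continuous_on_compose2) (auto intro!: continuous_intros)
  then show ?thesis by simp
qed

text \<open>A direction killed by the derivative at \<open>0\<close> of the orbit map spans a line contained in the
  stabilizer.\<close>

lemma orbit_map_constant_along_critical_direction:
  fixes A :: "('m::topological_space, 'e::euclidean_space) chart set"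
    and \<alpha> :: "(real ^ 'k) \<Rightarrow> 'm \<Rightarrow> 'm"
  assumes A: "smooth_atlas A"
    and sys: "(\<mu>, \<alpha>) \<in> Er_systems \<theta> A"
    and c: "c \<in> A" "x \<in> dom_chart c"
    and v: "frechet_derivative (\<lambda>t. coord c (\<alpha> t x)) (at 0) v = 0"
  shows "\<alpha> (s *\<^sub>R v) x = x"
proof -
  have \<alpha>0: "\<alpha> 0 = id" and \<alpha>_add: "\<And>s t. \<alpha> (s + t) = \<alpha> s \<circ> \<alpha> t"
    and \<alpha>: "Cr_map \<theta> (prod_atlas euclidean_atlas A) A (\<lambda>(t, x). \<alpha> t x)"
    and diff: "\<And>t. \<alpha> t \<in> Diff_r \<theta> A"
    using sys unfolding Er_systems_def by auto
  define \<gamma> where "\<gamma> s = \<alpha> (s *\<^sub>R v) x" for s :: real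
  have \<gamma>0: "\<gamma> 0 = x"
    by (simp add: \<gamma>_def \<alpha>0)
  have \<gamma>_cont: "continuous_on UNIV \<gamma>"
    unfolding \<gamma>_def
    by (rule continuous_on_compose2[OF orbit_map_continuous[OF \<alpha>]]) (auto intro!: continuous_intros)
  have open_pre: "open (\<gamma> -` dom_chart d)" if "d \<in> A" for d
    using \<gamma>_cont is_chart_of_atlas[OF A that]
    by (auto simp: is_chart_def continuous_on_open_vimage)
  have der0: "((\<lambda>h. coord c (\<gamma> h)) has_derivative (\<lambda>_. 0)) (at 0)"
  proof -
    have "(\<lambda>t. coord c (\<alpha> t x)) differentiable (at 0)"
      using orbit_map_differentiable[OF A \<alpha> c(1), of 0 x] c(2) by (simp add: \<alpha>0)
    then have D: "((\<lambda>t. coord c (\<alpha> t x)) has_derivative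
        frechet_derivative (\<lambda>t. coord c (\<alpha> t x)) (at 0)) (at (0 *\<^sub>R v))"
      by (simp add: frechet_derivative_works)
    have "((\<lambda>h::real. h *\<^sub>R v) has_derivative (\<lambda>h. h *\<^sub>R v)) (at 0)"
      by (auto intro!: derivative_eq_intros)
    from diff_chain_at[OF this D] show ?thesis
      using v linear_frechet_derivative[OF \<open>(\<lambda>t. coord c (\<alpha> t x)) differentiable (at 0)\<close>]
      by (simp add: comp_def \<gamma>_def linear_cmul)
  qed
  have der: "((\<lambda>h. coord d (\<gamma> h)) has_derivative (\<lambda>_. 0)) (at s)"
    if d: "d \<in> A" "\<gamma> s \<in> dom_chart d" for d s
  proof -
    let ?F = "local_rep c d (\<alpha> (s *\<^sub>R v))"
    \<comment> \<open>The orbit curve near time \<open>s\<close> is the image under \<open>\<alpha> (s *\<^sub>R v)\<close> of the one near time \<open>0\<close>.\<close>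
    have "Cr_map \<theta> A A (\<alpha> (s *\<^sub>R v))"
      using diff[of "s *\<^sub>R v"] unfolding Diff_r_def by blast
    then have "?F differentiable (at (coord c (\<gamma> 0)))"
      using Cr_map_local_rep_differentiable[of \<theta> A A _ c d x] c d by (simp add: \<gamma>0, simp add: \<gamma>_def)
    then obtain F' where F': "(?F has_derivative F') (at (coord c (\<gamma> 0)))"
      unfolding differentiable_def by blast
    then have "F' 0 = 0"
      using has_derivative_linear linear_0 by blast
    with diff_chain_at[OF der0 F']
    have "((\<lambda>h. ?F (coord c (\<gamma> h))) has_derivative (\<lambda>_. 0)) (at 0)"
      by (simp add: comp_def)
    then have "((\<lambda>h. coord d (\<gamma> (s + h))) has_derivative (\<lambda>_. 0)) (at 0)"
    proof (rule has_derivative_transform_within_open[OF _ open_pre[OF c(1)]])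
      show "0 \<in> \<gamma> -` dom_chart c"
        using c \<gamma>0 by simp
      show "?F (coord c (\<gamma> h)) = coord d (\<gamma> (s + h))" if "h \<in> \<gamma> -` dom_chart c" for h
        using that inv_chart_coord[OF is_chart_of_atlas[OF A c(1)]]
        by (simp add: local_rep_def \<gamma>_def scaleR_left_distrib \<alpha>_add)
    qed
    moreover have "((\<lambda>u. u - s) has_derivative (\<lambda>h. h)) (at s)"
      by (auto intro!: derivative_eq_intros)
    ultimately show ?thesis
      using diff_chain_at[of "\<lambda>u. u - s" "\<lambda>h. h" s "\<lambda>h. coord d (\<gamma> (s + h))" "\<lambda>_. 0"]
      by (simp add: comp_def)
  qed
  have loc: "eventually (\<lambda>b. \<gamma> a = \<gamma> b) (at a within UNIV)" for a
  proof -
    obtain d where d: "d \<in> A" "\<gamma> a \<in> dom_chart d"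
      using ex_chart_around[OF A] .
    then obtain e where e: "e > 0" "ball a e \<subseteq> \<gamma> -` dom_chart d"
      using open_pre[OF d(1)] by (metis open_contains_ball vimageI)
    have "\<exists>k. \<forall>b\<in>ball a e. coord d (\<gamma> b) = k"
      by (rule has_derivative_zero_constant)
        (use e(2) in \<open>auto intro!: has_derivative_at_withinI[OF der[OF d(1)]]\<close>)
    then have "coord d (\<gamma> a) = coord d (\<gamma> b)" if "b \<in> ball a e" for b
      using that e(1) by (metis centre_in_ball)
    then have "\<gamma> a = \<gamma> b" if "b \<in> ball a e" for b
      using chart_coord_inj[OF is_chart_of_atlas[OF A d(1)]] that d(2) e(2)
      by (meson inj_onD subsetD vimageD)
    then show ?thesis
      using e(1) unfolding eventually_at by (metis dist_commute mem_ball)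
  qed
  have "\<gamma> s = \<gamma> 0"
    by (rule connected_local_const[OF connected_UNIV]) (use loc in auto)
  then show ?thesis
    using \<gamma>0 by (simp add: \<gamma>_def)
qed

lemma discrete_contains_no_line:
  fixes v :: "'a::real_normed_vector"
  assumes "topological_space_class.discrete S" "\<And>s. s *\<^sub>R v \<in> S"
  shows "v = 0"
proof (rule ccontr)
  assume "v \<noteq> 0"
  have "0 \<in> S"
    using assms(2)[of 0] by simp
  then obtain U where U: "open U" "U \<inter> S = {0}"
    using assms(1) unfolding discrete_def isolated_in_def by blast
  have "open ((\<lambda>s::real. s *\<^sub>R v) -` U)"
    by (rule open_vimage[OF U(1)]) (auto intro!: continuous_intros)
  moreover have "0 \<in> (\<lambda>s::real. s *\<^sub>R v) -` U"
    using U(2) by auto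
  ultimately obtain e where e: "e > 0" "ball 0 e \<subseteq> (\<lambda>s::real. s *\<^sub>R v) -` U"
    by (metis open_contains_ball)
  then have "(e / 2) *\<^sub>R v \<in> U"
    by (auto simp: subset_iff)
  then have "(e / 2) *\<^sub>R v \<in> U \<inter> S"
    using assms(2) by blast
  with U(2) e(1) \<open>v \<noteq> 0\<close> show False by auto
qed

lemma orbit_tangent_dim:
  fixes A :: "('m::topological_space, 'e::euclidean_space) chart set"
    and \<alpha> :: "(real ^ 'k) \<Rightarrow> 'm \<Rightarrow> 'm"
  assumes A: "smooth_atlas A"
    and sys: "(\<mu>, \<alpha>) \<in> Er_systems \<theta> A"
    and c: "c \<in> A" "x \<in> dom_chart c"
    and "topological_space_class.discrete (stabilizer \<alpha> x)"
  shows "subspace (orbit_tangent c \<alpha> x)" and "dim (orbit_tangent c \<alpha> x) = CARD('k)"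
proof -
  let ?D = "frechet_derivative (\<lambda>t. coord c (\<alpha> t x)) (at 0)"
  have "(\<lambda>t. coord c (\<alpha> t x)) differentiable (at 0)"
    using orbit_map_differentiable[OF A _ c(1), of \<theta> \<alpha> 0 x] sys c(2)
    by (simp add: Er_systems_def)
  then have lin: "linear ?D"
    by (rule linear_frechet_derivative)
  then show "subspace (orbit_tangent c \<alpha> x)"
    unfolding orbit_tangent_def by (rule linear_subspace_image[OF _ subspace_UNIV])
  have "v = 0" if "?D v = 0" for v
    using orbit_map_constant_along_critical_direction[OF A sys c that] assms(5)
    by (intro discrete_contains_no_line) (auto simp: stabilizer_def)
  then have "inj ?D"
    using linear_injective_0[OF lin] by blast
  then show "dim (orbit_tangent c \<alpha> x) = CARD('k)"
    unfolding orbit_tangent_def using dim_image_eq[OF lin, of UNIV] by simp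
qed


section \<open>Counting dimensions\<close>

text \<open>Only one nonzero vector from each summand is used: together with \<open>V0\<close> these vectors span a
  space of dimension \<open>dim V0 + card I\<close>.\<close>

lemma direct_sum_dim_lower_bound:
  fixes V0 :: "'e::euclidean_space set"
  assumes dec: "direct_sum_decomposition V0 I V" and "finite I"
    and V0: "subspace V0" and V: "\<And>i. i \<in> I \<Longrightarrow> subspace (V i)" "\<And>i. i \<in> I \<Longrightarrow> V i \<noteq> {0}"
  shows "dim V0 + card I \<le> DIM('e)"
proof -
  have "\<exists>w. w \<in> V i \<and> w \<noteq> 0" if "i \<in> I" for i
    using V[OF that] subspace_0 by blast
  then obtain w where w: "\<And>i. i \<in> I \<Longrightarrow> w i \<in> V i" "\<And>i. i \<in> I \<Longrightarrow> w i \<noteq> 0"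
    by metis
  \<comment> \<open>The second conjunct describes the span, so that a dependency of the next vector on the previous
    ones would be a second decomposition of that vector.\<close>
  have "dim (V0 \<union> w ` F) = dim V0 + card F \<and>
      (\<forall>v \<in> span (V0 \<union> w ` F). \<exists>v0\<in>V0. \<exists>a. v = v0 + (\<Sum>i\<in>F. a i *\<^sub>R w i))"
    if "F \<subseteq> I" for F
    using finite_subset[OF that \<open>finite I\<close>] that
  proof (induction F rule: finite_induct)
    case empty
    then show ?case
      using V0 by (simp add: span_eq_iff[THEN iffD2])
  next
    case (insert j F)
    then have j: "j \<in> I" "j \<notin> F" "F \<subseteq> I" "finite F"
      and dimF: "dim (V0 \<union> w ` F) = dim V0 + card F"
      and spanF: "\<And>v. v \<in> span (V0 \<union> w ` F) \<Longrightarrow> \<exists>v0\<in>V0. \<exists>a. v = v0 + (\<Sum>i\<in>F. a i *\<^sub>R w i)"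
      by auto
    have "w j \<notin> span (V0 \<union> w ` F)"
    proof
      assume "w j \<in> span (V0 \<union> w ` F)"
      then obtain v0 a where v0: "v0 \<in> V0" and wj: "w j = v0 + (\<Sum>i\<in>F. a i *\<^sub>R w i)"
        using spanF by blast
      \<comment> \<open>Members of \<open>PiE I V\<close> are undefined outside \<open>I\<close>, hence the restrictions to \<open>I\<close>.\<close>
      define p where "p = (\<lambda>i\<in>I. if i \<in> F then a i *\<^sub>R w i else 0)"
      define q where "q = (\<lambda>i\<in>I. if i = j then w j else 0)"
      have p: "p \<in> PiE I V" and q: "q \<in> PiE I V"
        using w(1) V(1) by (auto simp: p_def q_def subspace_scale subspace_0)
      have "(\<Sum>i\<in>I. p i) = (\<Sum>i\<in>I. if i \<in> F then a i *\<^sub>R w i else 0)"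
        by (intro sum.cong) (auto simp: p_def)
      also have "\<dots> = (\<Sum>i\<in>F. a i *\<^sub>R w i)"
        using j \<open>finite I\<close> by (simp add: sum.inter_restrict[symmetric] Int_absorb1)
      finally have sp: "w j = v0 + (\<Sum>i\<in>I. p i)"
        using wj by simp
      have "(\<Sum>i\<in>I. q i) = (\<Sum>i\<in>I. if i = j then w j else 0)"
        by (intro sum.cong) (auto simp: q_def)
      also have "\<dots> = w j"
        using j \<open>finite I\<close> by simp
      finally have sq: "w j = 0 + (\<Sum>i\<in>I. q i)"
        by simp
      define P where "P = (\<lambda>(u, z). u \<in> V0 \<and> z \<in> PiE I V \<and> w j = u + (\<Sum>i\<in>I. z i))"
      have "\<exists>!y. P y"
        using dec unfolding direct_sum_decomposition_def P_def by blast
      moreover have "P (v0, p)"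
        unfolding P_def prod.case using v0 p sp by blast
      moreover have "P (0, q)"
        unfolding P_def prod.case using q sq subspace_0[OF V0] by blast
      ultimately have "(v0, p) = (0, q)"
        by blast
      then have "p j = q j" by simp
      then show False
        using j w(2) by (simp add: p_def q_def)
    qed
    then have "dim (V0 \<union> w ` insert j F) = dim V0 + card (insert j F)"
      using dimF j by (simp add: dim_insert)
    moreover have "\<exists>v0\<in>V0. \<exists>a. v = v0 + (\<Sum>i\<in>insert j F. a i *\<^sub>R w i)"
      if "v \<in> span (V0 \<union> w ` insert j F)" for v
    proof -
      obtain b where "v - b *\<^sub>R w j \<in> span (V0 \<union> w ` F)"
        using \<open>v \<in> _\<close> by (auto simp: span_insert)
      then obtain v0 a where v0: "v0 \<in> V0" "v - b *\<^sub>R w j = v0 + (\<Sum>i\<in>F. a i *\<^sub>R w i)"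
        using spanF by blast
      have "(\<Sum>i\<in>insert j F. (a(j := b)) i *\<^sub>R w i) = b *\<^sub>R w j + (\<Sum>i\<in>F. a i *\<^sub>R w i)"
        using j by (auto intro!: sum.cong)
      then have "v = v0 + (\<Sum>i\<in>insert j F. (a(j := b)) i *\<^sub>R w i)"
        using v0(2) by (simp add: algebra_simps)
      then show ?thesis
        using v0(1) by blast
    qed
    ultimately show ?case by blast
  qed
  from this[of I] have "dim V0 + card I = dim (V0 \<union> w ` I)"
    by simp
  then show ?thesis
    using dim_subset_UNIV[of "V0 \<union> w ` I"] by simp
qed

lemma card_lyapunov_hyperplanes_le:
  assumes "finite X"
  shows "card (lyapunov_hyperplanes X) \<le> card X"
proof -
  have "lyapunov_hyperplanes X \<subseteq> (\<lambda>\<xi>. {t. \<xi> t = 0}) ` X"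
    unfolding lyapunov_hyperplanes_def by blast
  then show ?thesis
    using surj_card_le[OF assms] by blast
qed

theorem corollary5:
  fixes A :: "('m::{second_countable_topology, t2_space}, 'e::euclidean_space) chart set"
    and \<theta> :: real
    and \<mu> :: "'m measure"
    and \<alpha> :: "(real ^ 'k) \<Rightarrow> 'm \<Rightarrow> 'm"
    and X :: "((real ^ 'k) \<Rightarrow> real) set"
  assumes "CARD('k) \<ge> 2"
    and "0 < \<theta>" and "\<theta> \<le> 1"
    and "compact_smooth_manifold A"
    and "(\<mu>, \<alpha>) \<in> Er_systems \<theta> A"
    and "essentially_locally_free \<mu> \<alpha>"
    and "ergodic_action \<mu> \<alpha>"
    and "nonorbital_lyapunov_exponents A \<mu> \<alpha> X"
    and "card (lyapunov_hyperplanes X) = CARD('k) + 1"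
    and "\<forall>t. t \<noteq> 0 \<longrightarrow> KS_entropy \<mu> (\<alpha> t) > 0"
    and "\<exists>t. K_property \<mu> (\<alpha> t)"
  shows "DIM('e) \<ge> 2 * CARD('k) + 1"
proof -
  have A: "smooth_atlas A"
    using assms(4) unfolding compact_smooth_manifold_def by blast
  obtain g L where "oseledets_splitting A g \<mu> \<alpha> X L"
    using assms(8) unfolding nonorbital_lyapunov_exponents_def by blast
  then have "finite X"
    and L: "\<And>\<xi> c x. \<xi> \<in> X \<Longrightarrow> c \<in> A \<Longrightarrow> x \<in> dom_chart c \<Longrightarrow> subspace (L \<xi> c x)"
    and split: "AE x in \<mu>. \<forall>c\<in>A. x \<in> dom_chart c \<longrightarrow>
        direct_sum_decomposition (orbit_tangent c \<alpha> x) X (\<lambda>\<xi>. L \<xi> c x) \<and>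
        (\<forall>\<xi>\<in>X. L \<xi> c x \<noteq> {0})"
    unfolding oseledets_splitting_def measurable_subspace_field_def by auto
  interpret prob_space \<mu>
    using assms(5) unfolding Er_systems_def by blast
  have "AE x in \<mu>. topological_space_class.discrete (stabilizer \<alpha> x) \<and>
      (\<forall>c\<in>A. x \<in> dom_chart c \<longrightarrow>
        direct_sum_decomposition (orbit_tangent c \<alpha> x) X (\<lambda>\<xi>. L \<xi> c x) \<and>
        (\<forall>\<xi>\<in>X. L \<xi> c x \<noteq> {0}))"
    using assms(6) split unfolding essentially_locally_free_def by (rule AE_conjI)
  from eventually_happens'[OF ae_filter_bot this]
  obtain x where discrete: "topological_space_class.discrete (stabilizer \<alpha> x)"
    and split_x: "\<forall>c\<in>A. x \<in> dom_chart c \<longrightarrow>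
        direct_sum_decomposition (orbit_tangent c \<alpha> x) X (\<lambda>\<xi>. L \<xi> c x) \<and>
        (\<forall>\<xi>\<in>X. L \<xi> c x \<noteq> {0})"
    by (elim exE conjE)
  obtain c where c: "c \<in> A" "x \<in> dom_chart c"
    using ex_chart_around[OF A] .
  note orbit = orbit_tangent_dim[OF A assms(5) c discrete]
  have dec: "direct_sum_decomposition (orbit_tangent c \<alpha> x) X (\<lambda>\<xi>. L \<xi> c x)"
    and nonzero: "\<And>\<xi>. \<xi> \<in> X \<Longrightarrow> L \<xi> c x \<noteq> {0}"
    using split_x c by blast+
  have "CARD('k) + card X \<le> DIM('e)"
    using direct_sum_dim_lower_bound[OF dec \<open>finite X\<close> orbit(1) L[OF _ c] nonzero] orbit(2)
    by simp
  moreover have "CARD('k) + 1 \<le> card X"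
    using card_lyapunov_hyperplanes_le[OF \<open>finite X\<close>] assms(9) by simp
  ultimately show ?thesis by simp
qed

end
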